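(* Let $S\subseteq\mathbb{R}_{\ge 0}$ be a positive semidomain that is bi-UFS. Suppose that $\ell:=\min(\mathcal{A}^+(S)\setminus\{1\})$ exists. Then $1<\ell\le\phi$, where $\phi=(1+\sqrt5)/2$ is the golden ratio.
   Context: All monoids are commutative and cancellative. A nonunit $a$ of a monoid $M$ is an atom if $a=xy$ with $x,y\in M$ forces $x$ or $y$ to be a unit. A monoid is a unique factorization monoid (UFM) if every nonunit factors into finitely many atoms, uniquely up to order and multiplication by units. A positive semidomain is a subset $S\subseteq\mathbb{R}_{\ge 0}$ containing $0$ and $1$ and closed under addition and multiplication; put $S^*=S\setminus\{0\}$. $S$ is bi-UFS if both $(S,+)$ and $(S^*,\cdot)$ are UFMs. $\mathcal{A}^+(S)$ denotes the set of atoms of $(S,+)$. *)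

theory Defs
  imports Complex_Main "HOL-Algebra.Divisibility"
begin

text \<open>
  A UFM is a \<^locale>\<open>factorial_monoid\<close>, which includes commutativity and
  cancellativity.
\<close>

definition positive_semidomain :: "real set \<Rightarrow> bool" where
  "positive_semidomain S \<longleftrightarrow>
     S \<subseteq> {0..} \<and> 0 \<in> S \<and> 1 \<in> S \<and>
     (\<forall>x\<in>S. \<forall>y\<in>S. x + y \<in> S) \<and> (\<forall>x\<in>S. \<forall>y\<in>S. x * y \<in> S)"

definition additive_monoid :: "real set \<Rightarrow> real monoid" where
  "additive_monoid S = \<lparr>carrier = S, mult = (+), one = 0\<rparr>"

definition multiplicative_monoid :: "real set \<Rightarrow> real monoid" where
  "multiplicative_monoid S = \<lparr>carrier = S - {0}, mult = (*), one = 1\<rparr>"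

definition bi_UFS :: "real set \<Rightarrow> bool" where
  "bi_UFS S \<longleftrightarrow>
     factorial_monoid (additive_monoid S) \<and> factorial_monoid (multiplicative_monoid S)"

definition atoms :: "('a, 'b) monoid_scheme \<Rightarrow> 'a set" where
  "atoms G = {a \<in> carrier G. irreducible G a}"

definition additive_atoms :: "real set \<Rightarrow> real set" where
  "additive_atoms S = atoms (additive_monoid S)"

text \<open>
  The library defines \<^const>\<open>irreducible\<close> through proper factors; in a commutative
  cancellative monoid this is the usual definition of an atom.
\<close>

lemma (in comm_monoid_cancel) atoms_iff:
  "a \<in> atoms G \<longleftrightarrow>
     a \<in> carrier G \<and> a \<notin> Units G \<and>
     (\<forall>x\<in>carrier G. \<forall>y\<in>carrier G. a = x \<otimes> y \<longrightarrow> x \<in> Units G \<or> y \<in> Units G)"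
  (is "?L \<longleftrightarrow> ?R")
proof
  assume ?L
  then have a: "a \<in> carrier G" and irr: "irreducible G a"
    by (auto simp: atoms_def)
  have "x \<in> Units G \<or> y \<in> Units G"
    if "x \<in> carrier G" "y \<in> carrier G" "a = x \<otimes> y" for x y
    using irreducible_prodE[of x y] irr that by blast
  with a irr show ?R by (auto simp: irreducible_def)
next
  assume R: ?R
  have "b \<in> Units G" if b: "b \<in> carrier G" and pf: "properfactor G b a" for b
  proof -
    from pf obtain c where c: "c \<in> carrier G" "a = b \<otimes> c"
      by (auto simp: properfactor_def factor_def)
    have "c \<notin> Units G"
    proof
      assume "c \<in> Units G"
      then have "a \<otimes> inv c = b" and "inv c \<in> carrier G"
        using b c by (simp_all add: m_assoc)
      then have "a divides b" by (auto simp: factor_def)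
      with pf show False by (simp add: properfactor_def)
    qed
    with R b c show ?thesis by blast
  qed
  with R show ?L by (auto simp: atoms_def irreducible_def)
qed

end

theory Submission
  imports Defs
begin

text \<open>
  The number \<open>1\<close> is always an additive atom (\<open>one_atom\<close>); write \<^term>\<open>l\<close> for the least of the
  others. If \<^term>\<open>l\<close> were below \<open>1\<close>, it would be a lower bound of all nonzero elements, which
  \<open>l\<^sup>2 < l\<close> refutes. So \<open>1 < l\<close>, and an element of \<^term>\<open>S\<close> below \<^term>\<open>l\<close> is a sum of copies
  of \<open>1\<close>, hence a natural number.

  Suppose that \<^term>\<open>l\<close> exceeds the golden ratio, that is, \<open>l\<^sup>2 > l + 1\<close>, and put
  \<open>k = \<lfloor>l\<rfloor>\<close>. Size estimates make \<^term>\<open>l\<close> and \<open>l + k\<close> multiplicatively irreducible, hence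
  prime (\<open>prime_l\<close>, \<open>prime_l_add\<close>). The product
  \<open>(l\<^sup>2 + k l + k\<^sup>2) (l\<^sup>3 + k\<^sup>3) = (l + k) (l\<^sup>4 + k\<^sup>2 l\<^sup>2 + k\<^sup>4)\<close>
  is then a failure of unique factorization, as it would be with an indeterminate in place of
  \<^term>\<open>l\<close>: the prime \<open>l + k\<close> has to divide a factor on the left, although the first is not a
  multiple of \<open>X + k\<close> as a polynomial and the quotient \<open>l\<^sup>2 - k l + k\<^sup>2\<close> of the second has a
  negative coefficient. What replaces the comparison of polynomials is unique factorization in
  \<open>(S, +)\<close>: if an atom occurs in one sum of atoms, then it occurs in every other sum with the
  same value. It forces \<open>l + k\<close> to divide a power of \<^term>\<open>l\<close> in the first case
  (\<open>l_add_not_dvd_sum_squares\<close>), and forces \<open>l\<^sup>2 = k l + n\<close> with a natural number \<open>n > 0\<close> in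
  the second (\<open>l_add_not_dvd_sum_cubes\<close>), which contradicts the primality of \<^term>\<open>l\<close>.
\<close>

section \<open>Both unique factorizations, in terms of real numbers\<close>

locale bi_unique_factorization =
  fixes S :: "real set"
  assumes semidomain: "positive_semidomain S"
    and bi_UFS: "bi_UFS S"
begin

lemma nonneg: "x \<in> S \<Longrightarrow> 0 \<le> x"
  and zero_in [simp, intro]: "0 \<in> S"
  and one_in [simp, intro]: "1 \<in> S"
  and add_in [intro]: "x \<in> S \<Longrightarrow> y \<in> S \<Longrightarrow> x + y \<in> S"
  and mult_in [intro]: "x \<in> S \<Longrightarrow> y \<in> S \<Longrightarrow> x * y \<in> S"
  using semidomain by (auto simp: positive_semidomain_def)

lemma of_nat_in [simp, intro]: "of_nat n \<in> S"
  by (induction n) auto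

lemma power_in [intro]: "x \<in> S \<Longrightarrow> x ^ n \<in> S"
  by (induction n) auto

lemma additive_factorial: "factorial_monoid (additive_monoid S)"
  and multiplicative_factorial: "factorial_monoid (multiplicative_monoid S)"
  using bi_UFS by (auto simp: bi_UFS_def)

lemma Units_additive: "Units (additive_monoid S) = {0}"
proof -
  have "x = 0" if "x \<in> S" "y \<in> S" "x + y = 0" for x y
    using that nonneg[of x] nonneg[of y] by linarith
  then show ?thesis
    by (auto simp: Units_def additive_monoid_def)
qed

lemma additive_atoms_iff:
  "a \<in> additive_atoms S \<longleftrightarrow>
     a \<in> S \<and> a \<noteq> 0 \<and> (\<forall>x\<in>S. \<forall>y\<in>S. a = x + y \<longrightarrow> x = 0 \<or> y = 0)"
proof -
  interpret factorial_monoid "additive_monoid S" by (rule additive_factorial)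
  show ?thesis
    unfolding additive_atoms_def atoms_iff Units_additive by (auto simp: additive_monoid_def)
qed

lemma atomD:
  assumes "a \<in> additive_atoms S"
  shows "a \<in> S" "0 < a"
  using assms nonneg[of a] by (auto simp: additive_atoms_iff)

lemma atom_diff_atom:
  assumes "a \<in> additive_atoms S" "b \<in> S" "b \<noteq> 0" "a - b \<in> S"
  shows "b = a"
proof -
  have "a = b + (a - b)" by simp
  then have "b = 0 \<or> a - b = 0"
    using assms unfolding additive_atoms_iff by blast
  with assms show ?thesis by simp
qed

text \<open>
  Divisibility of \<^term>\<open>x\<close> by \<^term>\<open>a\<close> in the monoid \<open>(S, +)\<close> means \<^term>\<open>x - a \<in> S\<close>, and is
  written in this form throughout.
\<close>

lemma exists_atom:
  assumes "x \<in> S" "x \<noteq> 0"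
  obtains a where "a \<in> additive_atoms S" "x - a \<in> S"
proof -
  interpret factorial_monoid "additive_monoid S" by (rule additive_factorial)
  have "x \<in> carrier (additive_monoid S)" "x \<notin> Units (additive_monoid S)"
    using assms unfolding Units_additive by (auto simp: additive_monoid_def)
  then obtain fs where fs: "set fs \<subseteq> carrier (additive_monoid S)" "factors (additive_monoid S) fs x"
    using factors_exist by blast
  show thesis
  proof (cases fs)
    case Nil
    with fs assms show thesis by (simp add: factors_def additive_monoid_def)
  next
    case (Cons a gs)
    have "a \<in> additive_atoms S"
      using fs Cons by (auto simp: factors_def additive_atoms_def atoms_def)
    moreover have "foldr (\<otimes>\<^bsub>additive_monoid S\<^esub>) gs \<one>\<^bsub>additive_monoid S\<^esub> \<in> S"
      using fs Cons multlist_closed[of gs] by (auto simp: additive_monoid_def)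
    then have "x - a \<in> S"
      using fs Cons by (auto simp: factors_def additive_monoid_def)
    ultimately show thesis by (rule that)
  qed
qed

lemma atom_prime:
  assumes a: "a \<in> additive_atoms S" and "x \<in> S" "y \<in> S" "x + y - a \<in> S"
  shows "x - a \<in> S \<or> y - a \<in> S"
proof -
  interpret factorial_monoid "additive_monoid S" by (rule additive_factorial)
  have dvd: "u divides\<^bsub>additive_monoid S\<^esub> v \<longleftrightarrow> v - u \<in> S" for u v
    by (auto simp: factor_def additive_monoid_def intro: bexI[of _ "v - u"])
  have "prime (additive_monoid S) a"
    using irreducible_prime a by (auto simp: additive_atoms_def atoms_def)
  then show ?thesis
    using prime_divides[of x y a] atomD[OF a] assms unfolding dvd
    by (auto simp: additive_monoid_def)
qed

text \<open>
  Iterated primality: if \<^term>\<open>c\<close> does not contain the atom \<^term>\<open>a\<close>, then all copies of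
  \<^term>\<open>a\<close> in \<^term>\<open>x + c\<close> come from \<^term>\<open>x\<close>.
\<close>

lemma atom_diff_cancel:
  assumes a: "a \<in> additive_atoms S" and c: "c \<in> S" "c - a \<notin> S"
    and "x \<in> S" "x + c - of_nat n * a \<in> S"
  shows "x - of_nat n * a \<in> S"
  using assms(4,5)
proof (induction n arbitrary: x)
  case 0
  then show ?case by simp
next
  case (Suc n)
  have "x + c - of_nat (Suc n) * a + of_nat n * a \<in> S"
    using Suc.prems atomD[OF a] by blast
  then have "x + c - a \<in> S"
    by (simp add: algebra_simps)
  then have "x - a \<in> S"
    using atom_prime[OF a Suc.prems(1) c(1)] c(2) by blast
  moreover have "(x - a) + c - of_nat n * a \<in> S"
    using Suc.prems by (simp add: algebra_simps)
  ultimately have "(x - a) - of_nat n * a \<in> S"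
    by (rule Suc.IH)
  then show ?case
    by (simp add: algebra_simps)
qed

lemma atom_diff_multiple:
  assumes a: "a \<in> additive_atoms S" and b: "b \<in> additive_atoms S"
    and "of_nat n * b - a \<in> S"
  shows "a = b"
  using assms(3)
proof (induction n)
  case 0
  then show ?case using nonneg[of "- a"] atomD[OF a] by simp
next
  case (Suc n)
  have "of_nat n * b \<in> S" using atomD[OF b] by blast
  then have "of_nat n * b - a \<in> S \<or> b - a \<in> S"
    using atom_prime[OF a _ atomD(1)[OF b], of "of_nat n * b"] Suc.prems
    by (simp add: algebra_simps)
  then show ?case
    using Suc.IH atom_diff_atom[OF b atomD(1)[OF a]] atomD(2)[OF a] by auto
qed

text \<open>
  If \<open>1\<close> were a sum \<open>a + r\<close> of an atom and a nonzero element, then \<open>a = a a + a r\<close> would be a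
  decomposition of the atom \<open>a\<close>.
\<close>

lemma one_atom: "1 \<in> additive_atoms S"
proof -
  obtain a where a: "a \<in> additive_atoms S" "1 - a \<in> S"
    using exists_atom[of 1] by auto
  have "a = a * a + a * (1 - a)" by (simp add: algebra_simps)
  moreover have "a * a \<in> S" "a * (1 - a) \<in> S" using a atomD by auto
  ultimately have "a * a = 0 \<or> a * (1 - a) = 0"
    using a(1) unfolding additive_atoms_iff by blast
  then have "a = 1" using atomD(2)[OF a(1)] by auto
  with a show ?thesis by simp
qed

text \<open>
  When no element lies strictly between \<open>0\<close> and \<open>1\<close>, the only multiplicative unit is \<open>1\<close>, so
  that irreducibility need only be tested on factors exceeding \<open>1\<close>.
\<close>

lemma irreducible_dvd_mult:
  assumes p: "p \<in> S" "1 < p"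
    and no_small: "\<And>x. x \<in> S \<Longrightarrow> x \<noteq> 0 \<Longrightarrow> 1 \<le> x"
    and irr: "\<And>x y. x \<in> S \<Longrightarrow> y \<in> S \<Longrightarrow> 1 < x \<Longrightarrow> 1 < y \<Longrightarrow> p \<noteq> x * y"
    and xy: "x \<in> S" "y \<in> S" "x \<noteq> 0" "y \<noteq> 0" and z: "z \<in> S" "x * y = p * z"
  shows "(\<exists>t\<in>S. x = p * t) \<or> (\<exists>t\<in>S. y = p * t)"
proof -
  interpret factorial_monoid "multiplicative_monoid S" by (rule multiplicative_factorial)
  have one_unit: "1 \<in> Units (multiplicative_monoid S)"
    using Units_one_closed by (simp add: multiplicative_monoid_def)
  have "u \<in> Units (multiplicative_monoid S) \<or> 1 < u" if "u \<in> S" "u \<noteq> 0" for u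
    using no_small[OF that] one_unit by force
  moreover have "p \<notin> Units (multiplicative_monoid S)"
  proof
    assume "p \<in> Units (multiplicative_monoid S)"
    then obtain q where "q \<in> S" "q \<noteq> 0" "q * p = 1"
      by (auto simp: Units_def multiplicative_monoid_def)
    moreover have "q * p > 1 * 1"
      using no_small[OF \<open>q \<in> S\<close> \<open>q \<noteq> 0\<close>] p by (intro mult_le_less_imp_less) auto
    ultimately show False by simp
  qed
  ultimately have "p \<in> atoms (multiplicative_monoid S)"
    using p irr unfolding atoms_iff by (fastforce simp: multiplicative_monoid_def)
  then have "prime (multiplicative_monoid S) p"
    using irreducible_prime by (auto simp: atoms_def)
  moreover have "p divides\<^bsub>multiplicative_monoid S\<^esub> x \<otimes>\<^bsub>multiplicative_monoid S\<^esub> y"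
    using xy z by (auto simp: factor_def multiplicative_monoid_def intro!: bexI[of _ z])
  ultimately have "p divides\<^bsub>multiplicative_monoid S\<^esub> x \<or> p divides\<^bsub>multiplicative_monoid S\<^esub> y"
    using prime_divides[of x y p] xy p by (auto simp: multiplicative_monoid_def)
  then show ?thesis
    by (auto simp: factor_def multiplicative_monoid_def)
qed

end

section \<open>The least atom other than 1\<close>

locale least_further_atom = bi_unique_factorization +
  fixes l :: real
  assumes atom: "l \<in> additive_atoms S" and neq_one: "l \<noteq> 1"
    and least: "\<And>a. a \<in> additive_atoms S \<Longrightarrow> a \<noteq> 1 \<Longrightarrow> l \<le> a"
begin

lemma l_in [simp, intro]: "l \<in> S"
  using atomD[OF atom] by simp

lemma l_gt_one: "1 < l"
proof (rule ccontr)
  assume "\<not> 1 < l"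
  then have "l < 1" using neq_one by simp
  have pos: "0 < l" using atomD[OF atom] by simp
  obtain a where a: "a \<in> additive_atoms S" "l * l - a \<in> S"
    using exists_atom[of "l * l"] pos by auto
  have "l \<le> a"
    using least[OF a(1)] \<open>l < 1\<close> by (cases "a = 1") auto
  moreover have "a \<le> l * l" using nonneg[OF a(2)] by simp
  moreover have "l * l < l" using pos \<open>l < 1\<close> by simp
  ultimately show False by simp
qed

lemma one_le:
  assumes "x \<in> S" "x \<noteq> 0"
  shows "1 \<le> x"
proof -
  obtain a where a: "a \<in> additive_atoms S" "x - a \<in> S"
    using exists_atom assms by blast
  then show ?thesis
    using nonneg[OF a(2)] least[OF a(1)] l_gt_one by (cases "a = 1") auto
qed

lemma below_l_nat:
  assumes "x \<in> S" "x < l"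
  shows "\<exists>n. x = of_nat n"
  using assms
proof (induction "nat \<lfloor>x\<rfloor>" arbitrary: x rule: less_induct)
  case less
  show ?case
  proof (cases "x = 0")
    case True
    then show ?thesis by (intro exI[of _ 0]) simp
  next
    case False
    obtain a where a: "a \<in> additive_atoms S" "x - a \<in> S"
      using exists_atom less.prems(1) False by blast
    have "a = 1"
      using least[OF a(1)] nonneg[OF a(2)] less.prems(2) by fastforce
    have "1 \<le> x" using one_le less.prems(1) False by simp
    then have "nat \<lfloor>x - 1\<rfloor> < nat \<lfloor>x\<rfloor>" by simp
    then obtain n where "x - 1 = of_nat n"
      using less.hyps[of "x - 1"] a(2) \<open>a = 1\<close> less.prems(2) by auto
    then have "x = of_nat (Suc n)" by simp
    then show ?thesis by blast
  qed
qed

lemma nat_diff_l: "of_nat n - l \<notin> S"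
  using atom_diff_multiple[OF atom one_atom, of n] neq_one by auto

lemma l_not_nat: "l \<noteq> of_nat n"
  using nat_diff_l[of n] by auto

lemma prime_l:
  assumes "x \<in> S" "y \<in> S" "x \<noteq> 0" "y \<noteq> 0" "z \<in> S" "x * y = l * z"
  shows "(\<exists>t\<in>S. x = l * t) \<or> (\<exists>t\<in>S. y = l * t)"
proof (rule irreducible_dvd_mult[OF l_in l_gt_one one_le _ assms])
  fix x y
  assume xy: "x \<in> S" "y \<in> S" "1 < x" "1 < y"
  show "l \<noteq> x * y"
  proof
    assume eq: "l = x * y"
    then have "x < l" "y < l" using xy by auto
    then obtain m n where "x = of_nat m" "y = of_nat n"
      using below_l_nat xy by blast
    then show False
      using eq l_not_nat[of "m * n"] by simp
  qed
qed

end

section \<open>A least atom above the golden ratio\<close>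

locale atom_above_golden_ratio = least_further_atom +
  fixes k :: nat
  assumes square_gt: "l + 1 < l * l"
    and k: "real k < l" "l < real k + 1"
begin

lemma k_pos: "1 \<le> k"
  using k l_gt_one by (cases k) auto

lemma square_gt_add: "l + k < l * l"
proof (cases "k = 1")
  case True
  then show ?thesis using square_gt by simp
next
  case False
  then have "2 < l" using k k_pos by linarith
  then have "2 * l < l * l" by simp
  then show ?thesis using k by linarith
qed

text \<open>
  In a product of two factors exceeding \<open>1\<close>, a factor below \<^term>\<open>l\<close> is a natural number
  \<open>n \<ge> 2\<close>, and two such factors would make \<^term>\<open>l\<close> an integer. Otherwise the product is at
  least \<open>2 l\<close> or \<open>l\<^sup>2\<close>, both larger than \<^term>\<open>l + k\<close>.
\<close>

lemma prime_l_add: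
  assumes "x \<in> S" "y \<in> S" "x \<noteq> 0" "y \<noteq> 0" "z \<in> S" "x * y = (l + k) * z"
  shows "(\<exists>t\<in>S. x = (l + k) * t) \<or> (\<exists>t\<in>S. y = (l + k) * t)"
proof (rule irreducible_dvd_mult[OF _ _ one_le _ assms])
  show "l + k \<in> S" by auto
  show "1 < l + k" using l_gt_one by simp
next
  have nat_times_big: "of_nat n * y \<noteq> l + k" if "1 < real n" "l \<le> y" for n y
  proof -
    have "2 * l \<le> real n * y"
      using that l_gt_one by (intro mult_mono) auto
    then show ?thesis using k by linarith
  qed
  fix x y
  assume xy: "x \<in> S" "y \<in> S" "1 < x" "1 < y"
  consider "x < l" "y < l" | "x < l" "l \<le> y" | "l \<le> x" "y < l" | "l \<le> x" "l \<le> y"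
    by linarith
  then show "l + k \<noteq> x * y"
  proof cases
    case 1
    then obtain m n where mn: "x = of_nat m" "y = of_nat n"
      using below_l_nat xy by blast
    show ?thesis
    proof
      assume "l + k = x * y"
      then have "of_nat (m * n) - l = of_nat k" using mn by simp
      then show False using nat_diff_l[of "m * n"] by simp
    qed
  next
    case 2
    then obtain n where "x = of_nat n" using below_l_nat xy by blast
    then show ?thesis using nat_times_big[of n y] 2 xy by simp
  next
    case 3
    then obtain n where "y = of_nat n" using below_l_nat xy by blast
    then show ?thesis using nat_times_big[of n x] 3 xy by (simp add: mult.commute)
  next
    case 4
    then have "l * l \<le> x * y" using l_gt_one by (intro mult_mono) auto
    then show ?thesis using square_gt_add by linarith
  qed
qed

lemma l_add_not_dvd_power:
  assumes "t \<in> S" "l ^ n = (l + k) * t"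
  shows False
  using assms
proof (induction n arbitrary: t)
  case 0
  have "t \<noteq> 0" using 0 by auto
  then have "(l + k) * 1 \<le> (l + k) * t"
    using one_le[OF 0(1)] l_gt_one by (intro mult_left_mono) auto
  moreover have "(l + k) * t = 1" using 0 by simp
  ultimately show ?case using l_gt_one k_pos by simp
next
  case (Suc n)
  have "(\<exists>t\<in>S. l = (l + k) * t) \<or> (\<exists>t\<in>S. l ^ n = (l + k) * t)"
    using Suc.prems l_gt_one by (intro prime_l_add[of _ _ t]) auto
  then show ?case
  proof
    assume "\<exists>t\<in>S. l = (l + k) * t"
    then obtain t where t: "t \<in> S" "l = (l + k) * t" by blast
    then have "t \<noteq> 0" using l_gt_one by auto
    then have "(l + k) * 1 \<le> (l + k) * t"
      using one_le[OF t(1)] l_gt_one by (intro mult_left_mono) auto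
    then show False using t k_pos by simp
  qed (use Suc.IH in blast)
qed

text \<open>
  Let \<open>y\<close> be the quotient; it lies strictly between \<open>l\<close> and \<open>l + k\<close>. If \<open>y\<close> contains \<open>k\<close>
  copies of \<open>1\<close>, then \<open>(l + k) (y - k) = l\<^sup>2\<close>. Otherwise \<open>y = a + j\<close> with \<open>j < k\<close> and a single
  atom \<open>a \<noteq> 1\<close>: if \<open>j\<close> is the number of copies of \<open>1\<close> in \<open>y\<close>, then \<open>y - j - a < k < l\<close> is a
  natural number, hence \<open>0\<close>. Comparing additive factorizations
  shows that \<open>l\<^sup>2\<close> contains \<open>k\<close> copies of \<open>a\<close>, and this leads to
  \<open>l\<^sup>3 = (l + k) (l\<^sup>2 - k a + k (k - j))\<close>. In either case \<open>l + k\<close> divides a power of \<open>l\<close>.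
\<close>

lemma l_add_not_dvd_sum_squares:
  assumes y: "y \<in> S" and eq: "(l + k) * y = l\<^sup>2 + k * l + k\<^sup>2"
  shows False
proof -
  have "(l + k) * l < (l + k) * y"
    using eq k_pos by (simp add: algebra_simps power2_eq_square)
  then have y_gt: "l < y" using l_gt_one by simp
  have "(l + k) * y < (l + k) * (l + k)"
    using eq k_pos l_gt_one by (simp add: algebra_simps power2_eq_square)
  then have y_less: "y < l + k" using l_gt_one by simp
  show False
  proof (cases "y - k \<in> S")
    case True
    have "l ^ 2 = (l + k) * (y - k)"
      using eq by (simp add: algebra_simps power2_eq_square)
    with True show False by (rule l_add_not_dvd_power)
  next
    case False
    define j where "j = (LEAST j. y - of_nat (Suc j) \<notin> S)"
    have ex: "y - of_nat (Suc (k - 1)) \<notin> S" using False k_pos by simp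
    then have j_max: "y - of_nat (Suc j) \<notin> S"
      unfolding j_def by (rule LeastI)
    have "j \<le> k - 1" unfolding j_def using ex by (rule Least_le)
    then have j_less: "j < k" using k_pos by simp
    have j_in: "y - of_nat j \<in> S"
    proof (cases j)
      case (Suc i)
      then have "i < (LEAST j. y - of_nat (Suc j) \<notin> S)" by (simp add: j_def)
      then show ?thesis using not_less_Least Suc by blast
    qed (use y in simp)
    obtain a where a: "a \<in> additive_atoms S" "y - j - a \<in> S"
      using exists_atom[OF j_in] y_gt k j_less by auto
    have a_neq_one: "a \<noteq> 1"
      using a(2) j_max by (auto simp: algebra_simps)
    then have "l \<le> a" using least a(1) by blast
    then have "y - j - a < l" using y_less k by linarith
    then obtain i where i: "y - j - a = of_nat i"
      using below_l_nat a(2) by blast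
    have "i = 0"
    proof (rule ccontr)
      assume "i \<noteq> 0"
      then have "y - of_nat (Suc j) = a + of_nat (i - 1)"
        using i by (simp add: of_nat_diff)
      then show False using j_max atomD(1)[OF a(1)] by auto
    qed
    then have y_eq: "y = a + j" using i by simp
    have a_neq_l: "a \<noteq> l"
    proof
      assume "a = l"
      then have eq_k: "(l + k) * j = k\<^sup>2"
        using eq y_eq by (simp add: algebra_simps power2_eq_square)
      then have "j \<noteq> 0" using k_pos by (intro notI) simp
      then have "of_nat (k\<^sup>2) - l = of_nat (j - 1) * l + of_nat (k * j)"
        using eq_k by (simp add: algebra_simps of_nat_diff)
      then show False using nat_diff_l[of "k\<^sup>2"] by auto
    qed
    \<comment> \<open>None of the copies of \<open>a\<close> in \<open>l\<^sup>2 + k l + k\<^sup>2\<close> comes from \<open>k l + k\<^sup>2\<close>.\<close>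
    have c: "of_nat k * l + of_nat (k\<^sup>2) * 1 - a \<notin> S"
      using atom_prime[OF a(1), of "of_nat k * l" "of_nat (k\<^sup>2) * 1"]
        atom_diff_multiple[OF a(1) atom, of k] atom_diff_multiple[OF a(1) one_atom, of "k\<^sup>2"]
        a_neq_one a_neq_l by auto
    have "l\<^sup>2 + (of_nat k * l + of_nat (k\<^sup>2) * 1) - of_nat k * a = of_nat (k * j) + l * a + l * j"
      using eq y_eq by (simp add: algebra_simps power2_eq_square)
    moreover have "of_nat (k * j) + l * a + l * of_nat j \<in> S"
      using atomD(1)[OF a(1)] by blast
    moreover have "of_nat k * l + of_nat (k\<^sup>2) * 1 \<in> S" by blast
    ultimately have w: "l\<^sup>2 - of_nat k * a \<in> S"
      using atom_diff_cancel[OF a(1) _ c, of "l\<^sup>2" k] by auto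
    have la: "l * a = l\<^sup>2 - k * a + (real k - j) * l + k * (real k - j)"
      using eq y_eq by (simp add: algebra_simps power2_eq_square)
    have "(l + k) * (l\<^sup>2 - k * a + k * (real k - j)) - l ^ 3
        = - k * (l * a - (l\<^sup>2 - k * a + (real k - j) * l + k * (real k - j)))"
      by (simp add: algebra_simps power2_eq_square power3_eq_cube)
    then have "l ^ 3 = (l + k) * (l\<^sup>2 - k * a + k * (real k - j))"
      using la by simp
    moreover have "l\<^sup>2 - of_nat k * a + of_nat (k * (k - j)) \<in> S"
      using w by blast
    ultimately show False
      using l_add_not_dvd_power[of "l\<^sup>2 - k * a + k * (real k - j)" 3] j_less by (simp add: of_nat_diff)
  qed
qed

text \<open>
  The quotient is \<open>l\<^sup>2 - k l + k\<^sup>2\<close>, so \<open>l\<^sup>2\<close> contains \<open>k\<close> copies of \<open>l\<close>. The remainder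
  \<open>l (l - k) < l\<close> is a natural number \<open>n > 0\<close>, whence \<open>l\<^sup>2 - 1\<close> and \<open>l\<^sup>2 - l\<close> belong to \<open>S\<close>
  and \<open>l (l\<^sup>2 - 1) = (l\<^sup>2 - l) (l + 1)\<close>. But the prime \<open>l\<close> divides neither factor on
  the right, because \<open>l - 1\<close> and \<open>1 + 1 / l\<close> are not in \<open>S\<close>.
\<close>

lemma l_add_not_dvd_sum_cubes:
  assumes t: "t \<in> S" and eq: "(l + k) * t = l ^ 3 + k ^ 3"
  shows False
proof -
  have "(l + k) * t = (l + k) * (l\<^sup>2 - k * l + k\<^sup>2)"
    using eq by (simp add: algebra_simps power2_eq_square power3_eq_cube)
  then have "t = l\<^sup>2 - k * l + k\<^sup>2" using l_gt_one by simp
  then have "l\<^sup>2 + of_nat (k\<^sup>2) - of_nat k * l = t" by simp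
  then have "l\<^sup>2 + of_nat (k\<^sup>2) - of_nat k * l \<in> S"
    using t by simp
  then have in_S: "l\<^sup>2 - of_nat k * l \<in> S"
    using atom_diff_cancel[OF atom of_nat_in nat_diff_l] by blast
  have "l * (l - k) < l * 1"
    using k l_gt_one by (intro mult_strict_left_mono) auto
  then have "l\<^sup>2 - of_nat k * l < l"
    by (simp add: algebra_simps power2_eq_square)
  then obtain n where n: "l\<^sup>2 - of_nat k * l = of_nat n"
    using below_l_nat in_S by blast
  have "l * (l - k) > 0" using k l_gt_one by simp
  then have n_pos: "0 < n" using n by (simp add: algebra_simps power2_eq_square)
  have "l\<^sup>2 - 1 = of_nat k * l + of_nat (n - 1)"
    using n n_pos by (simp add: of_nat_diff)
  then have 1: "l\<^sup>2 - 1 \<in> S" by auto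
  have "l\<^sup>2 - l = of_nat (k - 1) * l + of_nat n"
    using n k_pos by (simp add: of_nat_diff algebra_simps)
  then have 2: "l\<^sup>2 - l \<in> S" by auto
  have "(\<exists>t\<in>S. l\<^sup>2 - l = l * t) \<or> (\<exists>t\<in>S. l + 1 = l * t)"
  proof (rule prime_l[OF 2 _ _ _ 1])
    show "l\<^sup>2 - l \<noteq> 0" "l + 1 \<noteq> 0"
      using l_gt_one by (auto simp: power2_eq_square)
    show "(l\<^sup>2 - l) * (l + 1) = l * (l\<^sup>2 - 1)"
      by (simp add: algebra_simps power2_eq_square)
  qed auto
  then show False
  proof
    assume "\<exists>t\<in>S. l\<^sup>2 - l = l * t"
    then obtain t where t: "t \<in> S" "l * (l - 1) = l * t"
      by (auto simp: algebra_simps power2_eq_square)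
    then have "l - 1 \<in> S" using l_gt_one by auto
    then have "1 = l" by (intro atom_diff_atom[OF atom]) auto
    then show False using neq_one by simp
  next
    assume "\<exists>t\<in>S. l + 1 = l * t"
    then obtain t where t: "t \<in> S" "l + 1 = l * t" by blast
    have "l * t < l * l" using t square_gt by simp
    then have "t < l" using l_gt_one by simp
    then obtain m where m: "t = of_nat m" using below_l_nat t(1) by blast
    have "t = 1 + 1 / l" using t(2) l_gt_one by (simp add: field_simps)
    then have "1 < t" "t < 2" using l_gt_one by auto
    then show False using m by auto
  qed
qed

lemma contradiction: False
proof -
  have pos: "0 < l\<^sup>2 + k * l + k\<^sup>2" "0 < l ^ 3 + k ^ 3"
    using l_gt_one by (auto intro!: add_pos_nonneg)
  have "(\<exists>t\<in>S. l\<^sup>2 + k * l + k\<^sup>2 = (l + k) * t) \<or> (\<exists>t\<in>S. l ^ 3 + k ^ 3 = (l + k) * t)"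
  proof (rule prime_l_add)
    have "l ^ 4 + of_nat (k\<^sup>2) * l\<^sup>2 + of_nat (k ^ 4) \<in> S" by blast
    then show "l ^ 4 + k\<^sup>2 * l\<^sup>2 + k ^ 4 \<in> S" by simp
    have "l\<^sup>2 + of_nat k * l + of_nat (k\<^sup>2) \<in> S" "l ^ 3 + of_nat (k ^ 3) \<in> S" by blast+
    then show "l\<^sup>2 + k * l + k\<^sup>2 \<in> S" "l ^ 3 + k ^ 3 \<in> S" by simp_all
    show "(l\<^sup>2 + k * l + k\<^sup>2) * (l ^ 3 + k ^ 3) = (l + k) * (l ^ 4 + k\<^sup>2 * l\<^sup>2 + k ^ 4)"
      by (simp add: algebra_simps power2_eq_square power3_eq_cube power4_eq_xxxx)
  qed (use pos in auto)
  then show False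
    using l_add_not_dvd_sum_squares l_add_not_dvd_sum_cubes by metis
qed

end

theorem lemma3p19:
  fixes S :: "real set" and l :: real
  assumes "positive_semidomain S"
    and "bi_UFS S"
    and "l \<in> additive_atoms S - {1}"
    and "\<And>a. a \<in> additive_atoms S - {1} \<Longrightarrow> l \<le> a"
  shows "1 < l \<and> l \<le> (1 + sqrt 5) / 2"
proof -
  interpret least_further_atom S l
    using assms by unfold_locales auto
  have "l \<le> (1 + sqrt 5) / 2"
  proof (rule ccontr)
    assume "\<not> l \<le> (1 + sqrt 5) / 2"
    then have "sqrt 5 < 2 * l - 1" by (simp add: field_simps)
    then have "(sqrt 5)\<^sup>2 < (2 * l - 1)\<^sup>2" by (intro power_strict_mono) auto
    then have "l + 1 < l * l" by (simp add: algebra_simps power2_eq_square)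
    moreover have "real (nat \<lfloor>l\<rfloor>) < l" "l < real (nat \<lfloor>l\<rfloor>) + 1"
      using l_gt_one l_not_nat[of "nat \<lfloor>l\<rfloor>"] by linarith+
    ultimately interpret atom_above_golden_ratio S l "nat \<lfloor>l\<rfloor>"
      by unfold_locales
    show False by (rule contradiction)
  qed
  with l_gt_one show ?thesis by simp
qed

end
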